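(* Let $\psi:\mathbb{R}^n\to\mathbb{R}$, $\psi(x)=u^Tx$ with $u\in\mathbb{Z}^n$, let $C,D\subseteq\mathbb{R}^n$ be lattice polytopes and $w\in\mathbb{R}^n$. Then \begin{align*} &\Sigma_\psi(\mathrm{face}_w(C),\mathrm{face}_w(D))+\sum_{i=\psi_{C+D}}^{\psi_{\mathrm{face}_w(C+D)}-1}[C+D]_i+\sum_{i=\psi^{\mathrm{face}_w(C+D)}}^{\psi^{C+D}-1}[C+D]_i\\ &=\mathrm{face}_w\Sigma_\psi(C,D)+\sum_{i=\psi_C}^{\psi_{\mathrm{face}_w(C)}-1}[C]_i+\sum_{i=\psi^{\mathrm{face}_w(C)}}^{\psi^C-1}[C]_i+\sum_{i=\psi_D}^{\psi_{\mathrm{face}_w(D)}-1}[D]_i+\sum_{i=\psi^{\mathrm{face}_w(D)}}^{\psi^D-1}[D]_i . \end{align*}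
   Context: For a polytope $Q$, $\mathrm{face}_w(Q)=\arg\max_{x\in Q}w^Tx$. For a lattice polytope $Q$, $\psi_Q=\min_{x\in Q}\psi(x)$ and $\psi^Q=\max_{x\in Q}\psi(x)$. The fiber polytope is the Minkowski integral $\Sigma_\psi(Q)=\int_{\psi(Q)}(\psi^{-1}(x)\cap Q)\,dx$, which for lattice polytopes equals $\sum_{i=\psi_Q}^{\psi^Q-1}(\psi^{-1}(i+\frac12)\cap Q)$. The mixed fiber polytope $\Sigma_\psi(C,D)$ is the coefficient of $\lambda_1\lambda_2$ in $\Sigma_\psi(\lambda_1C+\lambda_2D)=\lambda_1^2M_{20}+\lambda_1\lambda_2M_{11}+\lambda_2^2M_{02}$, i.e. $\Sigma_\psi(C,D)=M_{11}$. For $i\in\mathbb{Z}$ and a polytope $Q$, $[Q]_i:=\arg\max_{x\in Q\cap\psi^{-1}(i+\frac12)}w^Tx$; sums of these sets are Minkowski sums. *)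

theory Defs
  imports "HOL-Analysis.Analysis"
begin

text \<open>Minkowski sums of sets are given by the instance of plus on sets
(HOL-Library.Set_Algebras); finite Minkowski sums are sums over sets of sets,
the empty Minkowski sum being the set containing only zero.\<close>

definition int_vec :: "real^'n \<Rightarrow> bool" where
  "int_vec x \<longleftrightarrow> (\<forall>i. x $ i \<in> \<int>)"

definition lattice_polytope :: "(real^'n) set \<Rightarrow> bool" where
  "lattice_polytope Q \<longleftrightarrow>
     (\<exists>V. finite V \<and> V \<noteq> {} \<and> (\<forall>v\<in>V. int_vec v) \<and> Q = convex hull V)"

definition face :: "real^'n \<Rightarrow> (real^'n) set \<Rightarrow> (real^'n) set" where
  "face w Q = {x \<in> Q. \<forall>y\<in>Q. w \<bullet> y \<le> w \<bullet> x}"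

definition psi_min :: "real^'n \<Rightarrow> (real^'n) set \<Rightarrow> real" where
  "psi_min u Q = Inf ((\<lambda>x. u \<bullet> x) ` Q)"

definition psi_max :: "real^'n \<Rightarrow> (real^'n) set \<Rightarrow> real" where
  "psi_max u Q = Sup ((\<lambda>x. u \<bullet> x) ` Q)"

definition supp :: "(real^'n) set \<Rightarrow> real^'n \<Rightarrow> real" where
  "supp K v = Sup ((\<lambda>x. v \<bullet> x) ` K)"

definition mink_integral :: "real \<Rightarrow> real \<Rightarrow> (real \<Rightarrow> (real^'n) set) \<Rightarrow> (real^'n) set" where
  "mink_integral a b F = (THE S. compact S \<and> convex S \<and> S \<noteq> {} \<and>
      (\<forall>v. supp S v = integral {a..b} (\<lambda>t. supp (F t) v)))"

definition fiber_polytope :: "real^'n \<Rightarrow> (real^'n) set \<Rightarrow> (real^'n) set" where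
  "fiber_polytope u Q =
     mink_integral (psi_min u Q) (psi_max u Q) (\<lambda>t. {x \<in> Q. u \<bullet> x = t})"

definition mixed_fiber_polytope ::
    "real^'n \<Rightarrow> (real^'n) set \<Rightarrow> (real^'n) set \<Rightarrow> (real^'n) set" where
  "mixed_fiber_polytope u C D = (THE M11. compact M11 \<and> convex M11 \<and> M11 \<noteq> {} \<and>
     (\<exists>M20 M02. compact M20 \<and> convex M20 \<and> M20 \<noteq> {} \<and>
                compact M02 \<and> convex M02 \<and> M02 \<noteq> {} \<and>
        (\<forall>l1 l2. 0 \<le> l1 \<longrightarrow> 0 \<le> l2 \<longrightarrow>
           fiber_polytope u ((\<lambda>x. l1 *\<^sub>R x) ` C + (\<lambda>x. l2 *\<^sub>R x) ` D) =
             (\<lambda>x. (l1\<^sup>2) *\<^sub>R x) ` M20 + (\<lambda>x. (l1 * l2) *\<^sub>R x) ` M11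
             + (\<lambda>x. (l2\<^sup>2) *\<^sub>R x) ` M02)))"

definition slice_face :: "real^'n \<Rightarrow> real^'n \<Rightarrow> (real^'n) set \<Rightarrow> int \<Rightarrow> (real^'n) set" where
  "slice_face u w Q i = face w {x \<in> Q. u \<bullet> x = of_int i + 1/2}"

definition int_range :: "real \<Rightarrow> real \<Rightarrow> int set" where
  "int_range a b = {i::int. a \<le> of_int i \<and> of_int i \<le> b - 1}"

end

theory Submission
  imports Defs
begin

text \<open>A lattice polytope interpolates its slices linearly between consecutive integer levels, so its
  fiber polytope is the Minkowski sum of the slices at half-integer levels. Since faces distribute
  over Minkowski sums, and since a slice of \<open>Q\<close> at a level met by \<open>face w Q\<close> has as its
  \<open>w\<close>-face the slice of \<open>face w Q\<close>, the \<open>w\<close>-face of the fiber polytope of \<open>Q\<close> is the fiber polytope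
  of \<open>face w Q\<close> plus the two tail sums of \<open>slice_face u w Q\<close>. Applying this to \<open>C + D\<close>, \<open>C\<close> and \<open>D\<close>, and
  expanding the fiber polytopes of \<open>C + D\<close> and of \<open>face w C + face w D\<close>, the theorem follows by
  cancellation.

  The existence of the mixed fiber polytope needs an argument. In each direction \<open>v\<close>, the upper
  boundary of the projection of \<open>l1 C + l2 D\<close> by \<open>(u, v)\<close> is obtained by merging the edges of the two
  upper boundaries by slope. The order of merging, a monotone staircase on the grid of integer levels,
  does not depend on \<open>l1, l2\<close>, so the integral is quadratic in \<open>l1, l2\<close>. Its mixed coefficient is the
  maximum over all staircases of a sum of support functions of slices, hence the support function of
  a convex body.\<close>

section \<open>Support functions and faces of convex bodies\<close>

definition convex_body :: "(real^'n) set \<Rightarrow> bool" where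
  "convex_body S \<longleftrightarrow> compact S \<and> convex S \<and> S \<noteq> {}"

lemma supp_eqI:
  assumes "x \<in> S" "\<And>y. y \<in> S \<Longrightarrow> v \<bullet> y \<le> v \<bullet> x"
  shows "supp S v = v \<bullet> x"
  unfolding supp_def using assms by (intro cSup_eq_maximum) auto

lemma supp_attained:
  assumes "compact S" "S \<noteq> {}"
  obtains x where "x \<in> S" "supp S v = v \<bullet> x" "\<And>y. y \<in> S \<Longrightarrow> v \<bullet> y \<le> v \<bullet> x"
proof -
  have "continuous_on S (\<lambda>x. v \<bullet> x)" by (intro continuous_intros)
  with assms obtain x where "x \<in> S" "\<And>y. y \<in> S \<Longrightarrow> v \<bullet> y \<le> v \<bullet> x"
    using continuous_attains_sup[of S "\<lambda>x. v \<bullet> x"] by blast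
  then show ?thesis using that supp_eqI by blast
qed

lemma supp_upper:
  assumes "compact S" "x \<in> S"
  shows "v \<bullet> x \<le> supp S v"
  using supp_attained[of S v] assms by (metis empty_iff)

lemma convex_body_plus:
  assumes "convex_body S" "convex_body T"
  shows "convex_body (S + T)"
proof -
  have "S + T = {x + y |x y. x \<in> S \<and> y \<in> T}" by (auto simp: set_plus_def)
  then show ?thesis
    using assms compact_sums[of S T] convex_set_plus[of S T]
    by (auto simp: convex_body_def)
qed

lemma convex_body_singleton: "convex_body {x}"
  by (simp add: convex_body_def)

lemma convex_body_scale:
  "convex_body S \<Longrightarrow> convex_body ((\<lambda>x. c *\<^sub>R x) ` S)"
  by (simp add: convex_body_def compact_scaling convex_scaling)

lemma convex_body_sum:
  assumes "\<And>i. i \<in> I \<Longrightarrow> convex_body (S i)"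
  shows "convex_body (\<Sum>i\<in>I. S i)"
  using assms
proof (induction I rule: infinite_finite_induct)
  case (infinite A)
  then show ?case by (simp add: convex_body_singleton)
next
  case empty
  then show ?case by (simp add: convex_body_singleton)
next
  case (insert i I)
  show ?case
    unfolding sum.insert[OF insert.hyps] by (intro convex_body_plus insert.IH insert.prems) auto
qed

lemma convex_body_hull_Un:
  assumes "convex_body S" "convex_body T"
  shows "convex_body (convex hull (S \<union> T))"
  using assms by (auto simp: convex_body_def compact_Un intro!: compact_convex_hull)

lemma supp_plus:
  assumes "convex_body S" "convex_body T"
  shows "supp (S + T) v = supp S v + supp T v"
proof -
  obtain x where x: "x \<in> S" "supp S v = v \<bullet> x" "\<And>y. y \<in> S \<Longrightarrow> v \<bullet> y \<le> v \<bullet> x"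
    using supp_attained assms(1) unfolding convex_body_def by blast
  obtain x' where x': "x' \<in> T" "supp T v = v \<bullet> x'" "\<And>y. y \<in> T \<Longrightarrow> v \<bullet> y \<le> v \<bullet> x'"
    using supp_attained assms(2) unfolding convex_body_def by blast
  have "supp (S + T) v = v \<bullet> (x + x')"
  proof (rule supp_eqI)
    show "v \<bullet> y \<le> v \<bullet> (x + x')" if "y \<in> S + T" for y
      using that by (elim set_plus_elim) (auto simp: inner_add_right intro!: add_mono x x')
  qed (use x x' in auto)
  then show ?thesis using x x' by (simp add: inner_add_right)
qed

lemma supp_scale:
  assumes "convex_body S" "0 \<le> c"
  shows "supp ((\<lambda>x. c *\<^sub>R x) ` S) v = c * supp S v"
proof -
  obtain x where x: "x \<in> S" "supp S v = v \<bullet> x" "\<And>y. y \<in> S \<Longrightarrow> v \<bullet> y \<le> v \<bullet> x"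
    using supp_attained assms(1) unfolding convex_body_def by blast
  have "supp ((\<lambda>x. c *\<^sub>R x) ` S) v = v \<bullet> (c *\<^sub>R x)"
    by (rule supp_eqI) (use x assms(2) in \<open>auto intro!: mult_left_mono\<close>)
  then show ?thesis using x by simp
qed

lemma supp_singleton: "supp {x} v = v \<bullet> x"
  by (simp add: supp_def)

lemma supp_sum:
  assumes "finite I" "\<And>i. i \<in> I \<Longrightarrow> convex_body (S i)"
  shows "supp (\<Sum>i\<in>I. S i) v = (\<Sum>i\<in>I. supp (S i) v)"
  using assms
proof (induction I)
  case empty
  then show ?case by (simp add: supp_singleton)
next
  case (insert i I)
  have "supp (S i + sum S I) v = supp (S i) v + supp (sum S I) v"
    by (intro supp_plus convex_body_sum insert.prems) auto
  moreover have "supp (sum S I) v = (\<Sum>j\<in>I. supp (S j) v)"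
    by (intro insert.IH insert.prems) auto
  ultimately show ?case
    unfolding sum.insert[OF insert.hyps] by (rule trans[OF _ arg_cong])
qed

text \<open>This lets a maximum of support functions, such as the one in \<open>path_max\<close>, be
  realised by a convex body.\<close>

lemma supp_hull_Un:
  assumes "convex_body S" "convex_body T"
  shows "supp (convex hull (S \<union> T)) v = max (supp S v) (supp T v)"
proof -
  obtain x where x: "x \<in> S" "supp S v = v \<bullet> x" "\<And>y. y \<in> S \<Longrightarrow> v \<bullet> y \<le> v \<bullet> x"
    using supp_attained assms(1) unfolding convex_body_def by blast
  obtain x' where x': "x' \<in> T" "supp T v = v \<bullet> x'" "\<And>y. y \<in> T \<Longrightarrow> v \<bullet> y \<le> v \<bullet> x'"
    using supp_attained assms(2) unfolding convex_body_def by blast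
  define z where "z = (if v \<bullet> x \<le> v \<bullet> x' then x' else x)"
  have "convex hull (S \<union> T) \<subseteq> {y. v \<bullet> y \<le> v \<bullet> z}"
    by (rule hull_minimal) (use x(3) x'(3) in \<open>fastforce simp: z_def convex_halfspace_le\<close>)+
  moreover have "z \<in> convex hull (S \<union> T)"
    using x x' by (auto simp: z_def intro: hull_inc)
  ultimately have "supp (convex hull (S \<union> T)) v = v \<bullet> z"
    by (intro supp_eqI) auto
  then show ?thesis using x x' by (auto simp: z_def)
qed

text \<open>A point of one body outside the other is cut off by a hyperplane, and the support
  functions differ in a normal direction. The uniqueness behind both \<open>THE\<close> definitions
  rests on this.\<close>

lemma supp_inject:
  assumes "convex_body S" "convex_body T" "\<And>v. supp S v = supp T v"
  shows "S = T"
proof -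
  have "A \<subseteq> B" if A: "convex_body A" and B: "convex_body B" and eq: "\<And>v. supp A v = supp B v"
    for A B :: "(real^'n) set"
  proof (rule subsetI, rule ccontr)
    fix z assume "z \<in> A" "z \<notin> B"
    then obtain a b where ab: "a \<bullet> z < b" "\<And>x. x \<in> B \<Longrightarrow> a \<bullet> x > b"
      using separating_hyperplane_closed_point[of B z] B
      unfolding convex_body_def by (metis compact_imp_closed)
    obtain x where "x \<in> B" "supp B (- a) = (- a) \<bullet> x"
      using supp_attained[of B "- a"] B unfolding convex_body_def by blast
    then have "supp B (- a) < (- a) \<bullet> z" using ab(1) ab(2)[of x] by simp
    then show False
      using supp_upper[of A z "- a"] A \<open>z \<in> A\<close> eq unfolding convex_body_def by (metis not_less)
  qed
  with assms show ?thesis by (metis subset_antisym)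
qed

text \<open>Support functions are additive, so the cancellation takes place among real
  numbers.\<close>

lemma convex_body_add_left_cancel:
  assumes "convex_body K" "convex_body S" "convex_body T" "K + S = K + T"
  shows "S = T"
proof (rule supp_inject)
  show "supp S v = supp T v" for v
    using supp_plus[of K S v] supp_plus[of K T v] assms by simp
qed (use assms in auto)

section \<open>Faces as sets of maximisers of a linear functional\<close>

lemma face_iff_supp:
  assumes "compact S" "S \<noteq> {}"
  shows "face w S = {x \<in> S. w \<bullet> x = supp S w}"
proof -
  obtain x where "x \<in> S" "supp S w = w \<bullet> x" "\<And>y. y \<in> S \<Longrightarrow> w \<bullet> y \<le> w \<bullet> x"
    using supp_attained assms by blast
  then show ?thesis unfolding face_def by (auto intro: antisym)
qed

lemma face_face_of:
  assumes "convex_body S"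
  shows "face w S face_of S"
proof -
  have "S \<inter> {x. w \<bullet> x = supp S w} face_of S"
    by (rule face_of_Int_supporting_hyperplane_le)
      (use assms supp_upper in \<open>auto simp: convex_body_def\<close>)
  moreover have "face w S = S \<inter> {x. w \<bullet> x = supp S w}"
    using assms face_iff_supp[of S w] by (auto simp: convex_body_def)
  ultimately show ?thesis by simp
qed

lemma convex_body_face:
  assumes "convex_body S"
  shows "convex_body (face w S)"
proof -
  have S: "compact S" "convex S" "S \<noteq> {}" using assms by (auto simp: convex_body_def)
  obtain x where "x \<in> S" "supp S w = w \<bullet> x" using supp_attained[OF S(1,3)] by metis
  then have "face w S \<noteq> {}" unfolding face_iff_supp[OF S(1,3)] by auto
  then show ?thesis
    using face_face_of[OF assms] S face_of_imp_compact face_of_imp_convex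
    unfolding convex_body_def by blast
qed

text \<open>A sum \<open>x + y\<close> reaches the maximum \<open>supp S w + supp T w\<close> only
  if both summands are maximal.\<close>

lemma face_plus:
  assumes "convex_body S" "convex_body T"
  shows "face w (S + T) = face w S + face w T"
proof (intro subset_antisym subsetI)
  note cb = convex_body_plus[OF assms]
  have ne: "compact S" "S \<noteq> {}" "compact T" "T \<noteq> {}" "compact (S + T)" "S + T \<noteq> {}"
    using assms cb by (auto simp: convex_body_def)
  fix z
  {
    assume "z \<in> face w (S + T)"
    then obtain x y where z: "z = x + y" "x \<in> S" "y \<in> T" "w \<bullet> z = supp S w + supp T w"
      using face_iff_supp[OF ne(5,6), of w] supp_plus[OF assms, of w] by (auto elim!: set_plus_elim)
    moreover have "w \<bullet> x \<le> supp S w" "w \<bullet> y \<le> supp T w"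
      using z ne supp_upper by auto
    ultimately have "w \<bullet> x = supp S w" "w \<bullet> y = supp T w"
      by (simp_all add: inner_add_right)
    then show "z \<in> face w S + face w T"
      using z face_iff_supp[OF ne(1,2), of w] face_iff_supp[OF ne(3,4), of w] by auto
  next
    assume "z \<in> face w S + face w T"
    then obtain x y where "z = x + y" "x \<in> face w S" "y \<in> face w T"
      by (elim set_plus_elim)
    then show "z \<in> face w (S + T)"
      unfolding face_iff_supp[OF ne(1,2)] face_iff_supp[OF ne(3,4)] face_iff_supp[OF ne(5,6)]
        supp_plus[OF assms] by (auto simp: inner_add_right)
  }
qed

lemma face_sum:
  assumes "finite I" "\<And>i. i \<in> I \<Longrightarrow> convex_body (S i)"
  shows "face w (\<Sum>i\<in>I. S i) = (\<Sum>i\<in>I. face w (S i))"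
  using assms
proof (induction I)
  case empty
  then show ?case by (auto simp: face_def)
next
  case (insert i I)
  have "face w (S i + sum S I) = face w (S i) + face w (sum S I)"
    by (intro face_plus convex_body_sum insert.prems) auto
  moreover have "face w (sum S I) = (\<Sum>j\<in>I. face w (S j))"
    by (intro insert.IH insert.prems) auto
  ultimately show ?case
    unfolding sum.insert[OF insert.hyps] by (rule trans[OF _ arg_cong])
qed

section \<open>Slices of lattice polytopes\<close>

definition slice :: "real^'n \<Rightarrow> (real^'n) set \<Rightarrow> real \<Rightarrow> (real^'n) set" where
  "slice u Q t = {x \<in> Q. u \<bullet> x = t}"

lemma convex_body_lattice_polytope: "lattice_polytope Q \<Longrightarrow> convex_body Q"
  by (auto simp: lattice_polytope_def convex_body_def finite_imp_compact_convex_hull)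

lemma lattice_polytope_plus:
  assumes "lattice_polytope C" "lattice_polytope D"
  shows "lattice_polytope (C + D)"
proof -
  obtain V W where "finite V" "V \<noteq> {}" "\<forall>v\<in>V. int_vec v" "C = convex hull V"
    and "finite W" "W \<noteq> {}" "\<forall>v\<in>W. int_vec v" "D = convex hull W"
    using assms by (auto simp: lattice_polytope_def)
  moreover from this have "\<forall>x\<in>V + W. int_vec x"
    unfolding set_plus_def by (fastforce simp: int_vec_def)
  moreover have "V + W \<noteq> {}" using calculation unfolding set_plus_def by blast
  ultimately show ?thesis unfolding lattice_polytope_def
    by (intro exI[of _ "V + W"]) (simp add: convex_hull_set_plus finite_set_plus)
qed

text \<open>A face of a convex hull is the hull of some of the generators, so their integrality is
  inherited.\<close>

lemma lattice_polytope_face: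
  assumes "lattice_polytope Q"
  shows "lattice_polytope (face w Q)"
proof -
  obtain V where V: "finite V" "\<forall>v\<in>V. int_vec v" "Q = convex hull V"
    using assms by (auto simp: lattice_polytope_def)
  note cb = convex_body_lattice_polytope[OF assms]
  obtain W where "W \<subseteq> V" "face w Q = convex hull W"
    using face_of_convex_hull_subset[of V "face w Q"] face_face_of[OF cb, of w] V
    by (metis finite_imp_compact)
  moreover from this have "W \<noteq> {}"
    using convex_body_face[OF cb, of w] by (auto simp: convex_body_def)
  ultimately show ?thesis
    using V unfolding lattice_polytope_def by (meson finite_subset subsetD)
qed

lemma inner_int_vec: "int_vec u \<Longrightarrow> int_vec v \<Longrightarrow> u \<bullet> v \<in> \<int>"
  unfolding int_vec_def inner_vec_def by (intro Ints_sum) (simp add: Ints_mult)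

section \<open>Extreme levels of \<open>u\<close> on a polytope\<close>

lemma psi_max_eq_supp: "psi_max u Q = supp Q u"
  by (simp add: psi_max_def supp_def)

lemma psi_min_eq_supp: "psi_min u Q = - supp Q (- u)"
proof -
  have "uminus ` (\<lambda>x. u \<bullet> x) ` Q = (\<lambda>x. - u \<bullet> x) ` Q" by (simp add: image_image)
  then show ?thesis by (simp only: psi_min_def supp_def Inf_real_def)
qed

text \<open>The face in direction \<open>u\<close> is again a lattice polytope, so the maximum is
  taken at an integral generator.\<close>

lemma supp_lattice_polytope_Ints:
  assumes "int_vec u" "lattice_polytope Q"
  shows "supp Q u \<in> \<int>"
proof -
  obtain V where V: "finite V" "V \<noteq> {}" "\<forall>v\<in>V. int_vec v" "face u Q = convex hull V"
    using lattice_polytope_face[OF assms(2), of u] by (auto simp: lattice_polytope_def)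
  then obtain v where v: "v \<in> V" "v \<in> face u Q" by (metis all_not_in_conv hull_inc)
  then have "supp Q u = u \<bullet> v"
    by (auto simp: face_def intro: supp_eqI)
  then show ?thesis using inner_int_vec[OF assms(1)] V v by auto
qed

lemma psi_Ints:
  assumes "int_vec u" "lattice_polytope Q"
  shows "psi_min u Q \<in> \<int>" "psi_max u Q \<in> \<int>"
proof -
  have "int_vec (- u)" using assms(1) by (simp add: int_vec_def)
  then show "psi_min u Q \<in> \<int>" "psi_max u Q \<in> \<int>"
    using supp_lattice_polytope_Ints assms by (auto simp: psi_max_eq_supp psi_min_eq_supp)
qed

lemma psi_bounds:
  assumes "convex_body Q" "x \<in> Q"
  shows "psi_min u Q \<le> u \<bullet> x" "u \<bullet> x \<le> psi_max u Q"
  using supp_upper[of Q x u] supp_upper[of Q x "- u"] assms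
  by (auto simp: psi_max_eq_supp psi_min_eq_supp convex_body_def)

lemma psi_attained:
  assumes "convex_body Q"
  obtains x y where "x \<in> Q" "u \<bullet> x = psi_min u Q" "y \<in> Q" "u \<bullet> y = psi_max u Q"
proof -
  have Q: "compact Q" "Q \<noteq> {}" using assms by (auto simp: convex_body_def)
  obtain x where "x \<in> Q" "supp Q (- u) = - u \<bullet> x" using supp_attained[OF Q] by metis
  moreover obtain y where "y \<in> Q" "supp Q u = u \<bullet> y" using supp_attained[OF Q] by metis
  ultimately show ?thesis using that by (simp add: psi_max_eq_supp psi_min_eq_supp)
qed

text \<open>Only nonemptiness needs an argument: \<open>Q\<close> is connected, so every level
  between the extremes is attained.\<close>

lemma convex_body_slice:
  assumes "convex_body Q" "psi_min u Q \<le> t" "t \<le> psi_max u Q"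
  shows "convex_body (slice u Q t)"
proof -
  have eq: "slice u Q t = Q \<inter> {x. u \<bullet> x = t}" by (auto simp: slice_def)
  obtain x y where "x \<in> Q" "u \<bullet> x = psi_min u Q" "y \<in> Q" "u \<bullet> y = psi_max u Q"
    using psi_attained assms(1) by blast
  moreover have "connected Q" using assms(1) by (simp add: convex_body_def convex_connected)
  ultimately have "\<exists>z\<in>Q. u \<bullet> z = t"
    using connected_ivt_hyperplane[of Q x y u t] assms by auto
  then show ?thesis
    using assms(1) unfolding convex_body_def eq
    by (auto simp: convex_Int convex_hyperplane closed_hyperplane intro!: compact_Int_closed)
qed

text \<open>The segment from \<open>y\<close> to \<open>z\<close> crosses the levels
  \<open>i\<close> and \<open>i + 1\<close> at the parameters \<open>a\<close> and \<open>b\<close>.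
  As the level is affine along it, the point at level \<open>i + \<theta>\<close> divides the piece
  between the crossings with weight \<open>\<theta>\<close>.\<close>

lemma slice_interpolate:
  assumes "convex Q" "y \<in> Q" "z \<in> Q" "u \<bullet> y \<le> i" "i + 1 \<le> u \<bullet> z"
    and \<alpha>: "0 \<le> \<alpha>" "\<alpha> \<le> 1" and x: "u \<bullet> ((1 - \<alpha>) *\<^sub>R y + \<alpha> *\<^sub>R z) = i + \<theta>"
  shows "\<exists>p\<in>slice u Q i. \<exists>q\<in>slice u Q (i + 1).
    (1 - \<alpha>) *\<^sub>R y + \<alpha> *\<^sub>R z = (1 - \<theta>) *\<^sub>R p + \<theta> *\<^sub>R q"
proof -
  define L where "L = u \<bullet> z - u \<bullet> y"
  define P where "P = (\<lambda>s. (1 - s) *\<^sub>R y + s *\<^sub>R z)"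
  define a where "a = (i - u \<bullet> y) / L"
  define b where "b = (i + 1 - u \<bullet> y) / L"
  have L: "L > 0" "L \<ge> 1" using assms by (auto simp: L_def)
  have uP: "u \<bullet> P s = u \<bullet> y + s * L" for s
    by (simp add: P_def L_def inner_add_right algebra_simps)
  have ab: "0 \<le> a" "a \<le> 1" "0 \<le> b" "b \<le> 1"
    using assms L by (auto simp: a_def b_def divide_simps L_def)
  have "P s \<in> Q" if "0 \<le> s" "s \<le> 1" for s
    using that assms unfolding P_def by (auto intro: convexD_alt)
  moreover have "u \<bullet> P a = i" "u \<bullet> P b = i + 1"
    using L by (auto simp: uP a_def b_def)
  ultimately have pq: "P a \<in> slice u Q i" "P b \<in> slice u Q (i + 1)"
    using ab by (auto simp: slice_def)
  have "\<alpha> * L = i + \<theta> - u \<bullet> y" using x uP[of \<alpha>] by (simp add: P_def)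
  moreover have "a * L = i - u \<bullet> y" "b * L = i + 1 - u \<bullet> y"
    using L by (simp_all add: a_def b_def)
  then have "((1 - \<theta>) * a + \<theta> * b) * L = i + \<theta> - u \<bullet> y"
    by (simp add: distrib_right mult.assoc) (simp add: algebra_simps)
  ultimately have "\<alpha> = (1 - \<theta>) * a + \<theta> * b"
    using L by (metis mult_right_cancel less_irrefl)
  moreover have "P ((1 - \<theta>) * a + \<theta> * b) = (1 - \<theta>) *\<^sub>R P a + \<theta> *\<^sub>R P b"
    by (simp add: P_def algebra_simps)
  ultimately have "P \<alpha> = (1 - \<theta>) *\<^sub>R P a + \<theta> *\<^sub>R P b" by simp
  with pq show ?thesis unfolding P_def by blast
qed

text \<open>A lattice polytope has no vertex strictly between two consecutive integer levels, so each of
  its points there lies on a segment joining the two bounding slices.\<close>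

lemma slice_lattice_polytope:
  fixes i :: int and \<theta> :: real
  assumes u: "int_vec u" and Q: "lattice_polytope Q"
    and i: "psi_min u Q \<le> i" "i + 1 \<le> psi_max u Q" and \<theta>: "0 \<le> \<theta>" "\<theta> \<le> 1"
  shows "slice u Q (i + \<theta>) =
    (\<lambda>x. (1 - \<theta>) *\<^sub>R x) ` slice u Q i + (\<lambda>x. \<theta> *\<^sub>R x) ` slice u Q (i + 1)"
proof (intro subset_antisym subsetI)
  fix x assume x: "x \<in> slice u Q (i + \<theta>)"
  obtain V where V: "finite V" "V \<noteq> {}" "\<forall>v\<in>V. int_vec v" "Q = convex hull V"
    using Q by (auto simp: lattice_polytope_def)
  note cb = convex_body_lattice_polytope[OF Q]
  define V1 where "V1 = {v\<in>V. u \<bullet> v \<le> i}"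
  define V2 where "V2 = {v\<in>V. i + 1 \<le> u \<bullet> v}"
  have Vun: "V = V1 \<union> V2"
  proof -
    have "u \<bullet> v \<le> i \<or> i + 1 \<le> u \<bullet> v" if "v \<in> V" for v
    proof -
      have "u \<bullet> v \<in> \<int>" using V u that inner_int_vec by blast
      then obtain k :: int where "u \<bullet> v = k" by (auto elim: Ints_cases)
      then show ?thesis by (cases "k \<le> i") auto
    qed
    then show ?thesis by (auto simp: V1_def V2_def)
  qed
  have hull1: "convex hull V1 \<subseteq> {y. u \<bullet> y \<le> i}"
    by (rule hull_minimal) (auto simp: V1_def convex_halfspace_le)
  have hull2: "convex hull V2 \<subseteq> {y. i + 1 \<le> u \<bullet> y}"
    by (rule hull_minimal) (auto simp: V2_def convex_halfspace_ge)
  obtain m m' where m: "m \<in> Q" "u \<bullet> m = psi_min u Q" "m' \<in> Q" "u \<bullet> m' = psi_max u Q"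
    using psi_attained[OF cb] by blast
  \<comment> \<open>An empty \<open>V1\<close> would put all of \<open>Q\<close> at level
    \<open>i + 1\<close> or higher, against the minimum attained at \<open>m\<close>; an empty
    \<open>V2\<close> is excluded in the same way by \<open>m'\<close>.\<close>
  have "V1 \<noteq> {}"
  proof
    assume "V1 = {}"
    then have "m \<in> convex hull V2" using m V Vun by simp
    then show False using hull2 m i by auto
  qed
  moreover have "V2 \<noteq> {}"
  proof
    assume "V2 = {}"
    then have "m' \<in> convex hull V1" using m V Vun by simp
    then show False using hull1 m i by auto
  qed
  ultimately have "Q = {\<beta> *\<^sub>R y + \<alpha> *\<^sub>R z |\<beta> \<alpha> y z.
      0 \<le> \<beta> \<and> 0 \<le> \<alpha> \<and> \<beta> + \<alpha> = 1 \<and> y \<in> convex hull V1 \<and> z \<in> convex hull V2}"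
    using convex_hull_union_two[of "convex hull V1" "convex hull V2"]
      hull_Un[of convex V1 V2, OF convex_Inter] V Vun by simp
  moreover have "x \<in> Q" using x by (simp add: slice_def)
  ultimately obtain \<beta> \<alpha> y z where yz: "0 \<le> \<beta>" "0 \<le> \<alpha>" "\<beta> + \<alpha> = 1" "x = \<beta> *\<^sub>R y + \<alpha> *\<^sub>R z"
    "y \<in> convex hull V1" "z \<in> convex hull V2"
    by blast
  have "\<beta> = 1 - \<alpha>" using yz by simp
  have "y \<in> Q" "z \<in> Q"
    using yz V Vun hull_mono[of V1 V convex] hull_mono[of V2 V convex] by auto
  then have "\<exists>p\<in>slice u Q i. \<exists>q\<in>slice u Q (i + 1). x = (1 - \<theta>) *\<^sub>R p + \<theta> *\<^sub>R q"
    using slice_interpolate[of Q y z u "real_of_int i" \<alpha> \<theta>] yz hull1 hull2 cb x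
    unfolding \<open>\<beta> = 1 - \<alpha>\<close> by (auto simp: convex_body_def slice_def)
  then show "x \<in> (\<lambda>x. (1 - \<theta>) *\<^sub>R x) ` slice u Q i + (\<lambda>x. \<theta> *\<^sub>R x) ` slice u Q (i + 1)"
    by blast
next
  fix x assume "x \<in> (\<lambda>x. (1 - \<theta>) *\<^sub>R x) ` slice u Q i + (\<lambda>x. \<theta> *\<^sub>R x) ` slice u Q (i + 1)"
  then obtain p q where pq: "p \<in> slice u Q i" "q \<in> slice u Q (i + 1)" "x = (1 - \<theta>) *\<^sub>R p + \<theta> *\<^sub>R q"
    by (auto elim!: set_plus_elim)
  then have "x \<in> Q"
    using convex_body_lattice_polytope[OF Q] \<theta>
    by (auto simp: convex_body_def slice_def intro: convexD_alt)
  then show "x \<in> slice u Q (i + \<theta>)"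
    using pq(1,2) unfolding pq(3) slice_def by (simp add: inner_add_right) (simp add: algebra_simps)
qed

section \<open>Staircase paths and the integral of a supremal convolution\<close>

text \<open>The largest weight of a monotone staircase path from \<open>(0, 0)\<close> to \<open>(m, n)\<close>, where a unit step
  in the first coordinate at height \<open>j\<close> weighs \<open>q j\<close> and a unit step in the second coordinate at
  abscissa \<open>i\<close> weighs \<open>p i\<close>.\<close>

fun path_max :: "(nat \<Rightarrow> real) \<Rightarrow> (nat \<Rightarrow> real) \<Rightarrow> nat \<Rightarrow> nat \<Rightarrow> real" where
  "path_max p q 0 0 = 0"
| "path_max p q (Suc m) 0 = q 0 + path_max p q m 0"
| "path_max p q 0 (Suc n) = p 0 + path_max p q 0 n"
| "path_max p q (Suc m) (Suc n) =
     max (q (Suc n) + path_max p q m (Suc n)) (p (Suc m) + path_max p q (Suc m) n)"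

text \<open>Reflection in the diagonal exchanges the two kinds of steps, so that
  \<open>path_max_greedy\<close> serves both.\<close>

lemma path_max_swap: "path_max p q m n = path_max q p n m"
  by (induction p q m n rule: path_max.induct) (auto simp: max.commute)

lemma path_max_Suc_right: "p m + path_max p q m n \<le> path_max p q m (Suc n)"
  by (cases m) auto

text \<open>An exchange argument. Before a final step in the second coordinate, the best path takes
  a step in the first one, by induction or, for \<open>n = 0\<close>, by necessity. Exchanging the
  two gains the difference of the slopes, which is not negative.\<close>

lemma path_max_greedy:
  assumes "\<And>j. Suc (Suc j) \<le> Suc n \<Longrightarrow> q (Suc (Suc j)) - q (Suc j) \<le> q (Suc j) - q j"
    and "p (Suc m) - p m \<le> q (Suc n) - q n"
  shows "path_max p q (Suc m) (Suc n) = q (Suc n) + path_max p q m (Suc n)"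
  using assms
proof (induction n)
  case 0
  then show ?case using path_max_Suc_right[of p m q 0] by (simp add: max_def)
next
  case (Suc n)
  have "p (Suc m) - p m \<le> q (Suc n) - q n"
    using Suc.prems(1)[of n] Suc.prems(2) by simp
  then have "path_max p q (Suc m) (Suc n) = q (Suc n) + path_max p q m (Suc n)"
    using Suc.prems(1) by (intro Suc.IH) auto
  then show ?case
    using path_max_Suc_right[of p m q "Suc n"] Suc.prems(2)
    unfolding path_max.simps(4)[of p q m "Suc n"] by (simp add: max_def)
qed

text \<open>Concavity is recorded by the lines along the edges instead of by chords, because these
  lines supply the supergradients that certify optimality.\<close>

definition polygonal_concave :: "nat \<Rightarrow> (real \<Rightarrow> real) \<Rightarrow> bool" where
  "polygonal_concave M f \<longleftrightarrow>
    (\<forall>i<M. \<forall>\<theta>\<in>{0..1}. f (real i + \<theta>) = f (real i) + \<theta> * (f (real (Suc i)) - f (real i))) \<and>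
    (\<forall>i<M. \<forall>x\<in>{0..real M}. f x \<le> f (real i) + (f (real (Suc i)) - f (real i)) * (x - real i))"

lemma polygonal_concave_affine:
  assumes "polygonal_concave M f" "i < M" "0 \<le> \<theta>" "\<theta> \<le> 1"
  shows "f (real i + \<theta>) = f (real i) + \<theta> * (f (real (Suc i)) - f (real i))"
  using assms by (auto simp: polygonal_concave_def)

lemma polygonal_concave_tangent:
  assumes "polygonal_concave M f" "i < M" "0 \<le> x" "x \<le> real M"
  shows "f x \<le> f (real i) + (f (real (Suc i)) - f (real i)) * (x - real i)"
  using assms by (auto simp: polygonal_concave_def)

lemma polygonal_concave_slopes:
  assumes "polygonal_concave M f" "Suc (Suc i) \<le> M"
  shows "f (real (Suc (Suc i))) - f (real (Suc i)) \<le> f (real (Suc i)) - f (real i)"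
  using polygonal_concave_tangent[OF assms(1), of i "real (Suc (Suc i))"] assms(2)
  by (simp add: algebra_simps)

text \<open>Stated by characterising values instead of with a supremum: at a level where the pair
  \<open>(x, y)\<close> is optimal, \<open>k\<close> takes the value of that pair.\<close>

definition sup_convolution ::
    "real \<Rightarrow> real \<Rightarrow> nat \<Rightarrow> nat \<Rightarrow> (real \<Rightarrow> real) \<Rightarrow> (real \<Rightarrow> real) \<Rightarrow> (real \<Rightarrow> real) \<Rightarrow> bool" where
  "sup_convolution a b M N f g k \<longleftrightarrow>
    (\<forall>x\<in>{0..real M}. \<forall>y\<in>{0..real N}.
      (\<forall>x'\<in>{0..real M}. \<forall>y'\<in>{0..real N}.
        a * x' + b * y' = a * x + b * y \<longrightarrow> a * f x' + b * g y' \<le> a * f x + b * g y) \<longrightarrow>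
      k (a * x + b * y) = a * f x + b * g y)"

lemma sup_convolution_swap:
  "sup_convolution a b M N f g k \<Longrightarrow> sup_convolution b a N M g f k"
  unfolding sup_convolution_def by (simp add: add.commute)

text \<open>A common supergradient of \<open>f\<close> at \<open>x\<close> and of \<open>g\<close> at \<open>y\<close> certifies that \<open>(x, y)\<close> is optimal
  at its level.\<close>

lemma sup_convolution_eq:
  assumes "sup_convolution a b M N f g k" "0 \<le> a" "0 \<le> b"
    and "x \<in> {0..real M}" "y \<in> {0..real N}"
    and f: "\<And>x'. x' \<in> {0..real M} \<Longrightarrow> f x' \<le> f x + s * (x' - x)"
    and g: "\<And>y'. y' \<in> {0..real N} \<Longrightarrow> g y' \<le> g y + s * (y' - y)"
  shows "k (a * x + b * y) = a * f x + b * g y"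
proof -
  have "a * f x' + b * g y' \<le> a * f x + b * g y"
    if "x' \<in> {0..real M}" "y' \<in> {0..real N}" "a * x' + b * y' = a * x + b * y" for x' y'
  proof -
    have "a * f x' + b * g y' \<le> a * (f x + s * (x' - x)) + b * (g y + s * (y' - y))"
      using that assms by (intro add_mono mult_left_mono) auto
    also have "\<dots> = a * f x + b * g y + s * ((a * x' + b * y') - (a * x + b * y))"
      by (simp add: algebra_simps)
    finally show ?thesis using that by simp
  qed
  then show ?thesis using assms unfolding sup_convolution_def by blast
qed

section \<open>Integration along one step of the staircase\<close>

lemma has_integral_affine:
  fixes c s t l :: real
  assumes "0 \<le> l"
  shows "((\<lambda>x. c + s * (x - t)) has_integral (c * l + s * l\<^sup>2 / 2)) {t..t + l}"
proof -
  have "((\<lambda>x. c + s * (x - t)) has_integral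
      (c * (t + l) + s * ((t + l) - t)\<^sup>2 / 2) - (c * t + s * (t - t)\<^sup>2 / 2)) {t..t + l}"
    using assms
    by (intro fundamental_theorem_of_calculus)
      (auto intro!: derivative_eq_intros simp: has_real_derivative_iff_has_vector_derivative[symmetric])
  then show ?thesis by (simp add: algebra_simps)
qed

text \<open>While the first argument crosses one edge of \<open>f\<close> and the second rests at
  \<open>n\<close>, the slope of that edge is a common supergradient. Hence \<open>k\<close> is
  affine on an interval of length \<open>a\<close>, and its integral is \<open>a\<close> times its
  value at the midpoint; this is the source of the half-integer argument.\<close>

lemma sup_convolution_step:
  assumes f: "polygonal_concave M f" and k: "sup_convolution a b M N f g k"
    and ab: "0 \<le> a" "0 \<le> b" and mn: "Suc m \<le> M" "n \<le> N"
    and g: "\<And>y. y \<in> {0..real N} \<Longrightarrow>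
      g y \<le> g (real n) + (f (real (Suc m)) - f (real m)) * (y - real n)"
  shows "(k has_integral (a\<^sup>2 * f (real m + 1/2) + a * b * g (real n)))
    {a * real m + b * real n..a * real (Suc m) + b * real n}"
proof -
  define s where "s = f (real (Suc m)) - f (real m)"
  define t where "t = a * real m + b * real n"
  have on_step: "k (t + a * \<theta>) = a * f (real m) + b * g (real n) + s * (a * \<theta>)"
    if "0 \<le> \<theta>" "\<theta> \<le> 1" for \<theta>
  proof -
    have eq: "f (real m + \<theta>) = f (real m) + \<theta> * s"
      using polygonal_concave_affine[OF f, of m \<theta>] mn that by (simp add: s_def)
    have "k (a * (real m + \<theta>) + b * real n) = a * f (real m + \<theta>) + b * g (real n)"
    proof (rule sup_convolution_eq[OF k ab])
      show "f x' \<le> f (real m + \<theta>) + s * (x' - (real m + \<theta>))" if "x' \<in> {0..real M}" for x'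
        using polygonal_concave_tangent[OF f, of m x'] that mn
        unfolding eq s_def[symmetric] by (simp add: algebra_simps)
      show "g y' \<le> g (real n) + s * (y' - real n)" if "y' \<in> {0..real N}" for y'
        using g[OF that] by (simp add: s_def)
    qed (use mn that in auto)
    then show ?thesis unfolding eq t_def by (simp add: algebra_simps)
  qed
  have "((\<lambda>x. (a * f (real m) + b * g (real n)) + s * (x - t)) has_integral
      ((a * f (real m) + b * g (real n)) * a + s * a\<^sup>2 / 2)) {t..t + a}"
    by (rule has_integral_affine[OF ab(1)])
  then have "(k has_integral ((a * f (real m) + b * g (real n)) * a + s * a\<^sup>2 / 2)) {t..t + a}"
  proof (rule has_integral_eq[rotated])
    fix x assume x: "x \<in> {t..t + a}"
    \<comment> \<open>For \<open>a = 0\<close> the interval is the single point \<open>t\<close>,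
      and the default \<open>0\<close> still gives \<open>x = t + a * \<theta>\<close>.\<close>
    define \<theta> where "\<theta> = (if a = 0 then 0 else (x - t) / a)"
    have "0 \<le> \<theta>" "\<theta> \<le> 1" "x = t + a * \<theta>"
      using x ab by (auto simp: \<theta>_def field_simps)
    with on_step[of \<theta>]
    show "(a * f (real m) + b * g (real n)) + s * (x - t) = k x" by simp
  qed
  moreover have "f (real m + 1/2) = f (real m) + s / 2"
    using polygonal_concave_affine[OF f, of m "1/2"] mn by (simp add: s_def)
  ultimately show ?thesis
    by (simp add: t_def algebra_simps power2_eq_square)
qed

text \<open>The right-hand half of the claim that \<open>s\<close> is a supergradient of
  \<open>g\<close> at the node \<open>n\<close>.\<close>

definition dominates_after :: "real \<Rightarrow> nat \<Rightarrow> nat \<Rightarrow> (real \<Rightarrow> real) \<Rightarrow> bool" where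
  "dominates_after s n N g \<longleftrightarrow> (\<forall>y\<in>{real n..real N}. g y \<le> g (real n) + s * (y - real n))"

lemma dominates_after_mono:
  assumes "dominates_after s n N g" "s \<le> s'"
  shows "dominates_after s' n N g"
  unfolding dominates_after_def
proof
  fix y assume y: "y \<in> {real n..real N}"
  then have "s * (y - real n) \<le> s' * (y - real n)"
    using assms(2) by (intro mult_right_mono) auto
  then show "g y \<le> g (real n) + s' * (y - real n)"
    using assms(1) y unfolding dominates_after_def by fastforce
qed

lemma polygonal_concave_dominates_after:
  assumes "polygonal_concave N g" "n < N"
  shows "dominates_after (g (real (Suc n)) - g (real n)) n N g"
  using polygonal_concave_tangent[OF assms] by (auto simp: dominates_after_def)

text \<open>To the left of the node, the line along the preceding edge gives the bound, since its
  slope is at least \<open>s\<close>. At \<open>n = 0\<close> there is no such edge and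
  \<open>before\<close> is vacuous.\<close>

lemma polygonal_concave_tangent_node:
  assumes g: "polygonal_concave N g" and n: "n \<le> N"
    and after: "dominates_after s n N g"
    and before: "\<And>j. n = Suc j \<Longrightarrow> s \<le> g (real n) - g (real j)"
    and y: "y \<in> {0..real N}"
  shows "g y \<le> g (real n) + s * (y - real n)"
proof (cases "real n \<le> y")
  case True
  then show ?thesis using after y by (auto simp: dominates_after_def)
next
  case False
  then obtain j where j: "n = Suc j" using y by (cases n) auto
  have "g y \<le> g (real j) + (g (real n) - g (real j)) * (y - real j)"
    using polygonal_concave_tangent[OF g, of j y] y n j by simp
  also have "\<dots> = g (real n) + (g (real n) - g (real j)) * (y - real n)"
    by (simp add: j algebra_simps)
  also have "\<dots> \<le> g (real n) + s * (y - real n)"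
    using before[OF j] False by (intro add_left_mono mult_right_mono_neg) auto
  finally show ?thesis .
qed

text \<open>The next edge of \<open>f\<close> may be appended when its slope bounds the growth of
  \<open>g\<close> from \<open>n\<close> on and does not exceed the slope of the last edge of
  \<open>g\<close> already used.\<close>

lemma sup_convolution_extend:
  assumes f: "polygonal_concave M f" and g: "polygonal_concave N g"
    and k: "sup_convolution a b M N f g k" and ab: "0 \<le> a" "0 \<le> b" and mn: "Suc m \<le> M" "n \<le> N"
    and after: "dominates_after (f (real (Suc m)) - f (real m)) n N g"
    and before: "\<And>j. n = Suc j \<Longrightarrow> f (real (Suc m)) - f (real m) \<le> g (real n) - g (real j)"
    and I: "(k has_integral I) {0..a * real m + b * real n}"
  shows "(k has_integral (I + (a\<^sup>2 * f (real m + 1/2) + a * b * g (real n))))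
    {0..a * real (Suc m) + b * real n}"
  by (rule has_integral_combine[OF _ _ I sup_convolution_step[OF f k ab mn]])
    (use ab polygonal_concave_tangent_node[OF g mn(2) after before] in
      \<open>auto simp: mult_left_mono\<close>)

text \<open>The optimal pairs run along the staircase that takes its steps in order of decreasing slope,
  whatever the weights \<open>a\<close> and \<open>b\<close>; only the lengths of the steps depend on the weights.\<close>

lemma has_integral_sup_convolution_aux:
  assumes f: "polygonal_concave M f" and g: "polygonal_concave N g"
    and k: "sup_convolution a b M N f g k" and ab: "0 \<le> a" "0 \<le> b"
    and "m \<le> M" "n \<le> N"
    and "\<And>i. m = Suc i \<Longrightarrow> dominates_after (f (real m) - f (real i)) n N g"
    and "\<And>j. n = Suc j \<Longrightarrow> dominates_after (g (real n) - g (real j)) m M f"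
  shows "(k has_integral (a\<^sup>2 * (\<Sum>i<m. f (real i + 1/2))
      + a * b * path_max (\<lambda>i. f (real i)) (\<lambda>j. g (real j)) m n
      + b\<^sup>2 * (\<Sum>j<n. g (real j + 1/2)))) {0..a * real m + b * real n}"
  using assms(6-)
proof (induction "m + n" arbitrary: m n rule: less_induct)
  \<comment> \<open>The dominance hypotheses say that \<open>(m, n)\<close> lies on a staircase
    sorted by slope: the edge of either function that ends at its current node dominates what is
    left of the other.\<close>
  case less
  let ?p = "\<lambda>i. f (real i)" and ?q = "\<lambda>j. g (real j)"
  let ?F = "\<lambda>m. \<Sum>i<m. f (real i + 1/2)" and ?G = "\<lambda>n. \<Sum>j<n. g (real j + 1/2)"
  let ?I = "\<lambda>m n. a\<^sup>2 * ?F m + a * b * path_max ?p ?q m n + b\<^sup>2 * ?G n"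
  have step_f: "(k has_integral ?I (Suc i) n) {0..a * real (Suc i) + b * real n}"
    if m: "m = Suc i" and before: "\<And>j. n = Suc j \<Longrightarrow> ?p m - ?p i \<le> ?q n - ?q j"
      and path: "path_max ?p ?q (Suc i) n = ?q n + path_max ?p ?q i n" for i
  proof -
    have after: "dominates_after (?p (Suc i) - ?p i) n N g" using less.prems(3) m by simp
    have "(k has_integral ?I i n) {0..a * real i + b * real n}"
    proof (rule less.hyps)
      show "dominates_after (?p i - ?p i') n N g" if "i = Suc i'" for i'
        using dominates_after_mono[OF after] polygonal_concave_slopes[OF f, of i'] that m less.prems(1)
        by simp
      \<comment> \<open>Edge \<open>i\<close> of \<open>f\<close> is now among those still to come;
        by \<open>before\<close>, the last edge of \<open>g\<close> dominates it as well.\<close>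
      show "dominates_after (?q n - ?q j) i M f" if "n = Suc j" for j
        using dominates_after_mono[OF polygonal_concave_dominates_after[OF f, of i]]
          before[OF that] m less.prems(1) by simp
    qed (use m less.prems in auto)
    from sup_convolution_extend[OF f g k ab _ _ after _ this] before m less.prems(1,2)
    have "(k has_integral ?I i n + (a\<^sup>2 * f (real i + 1/2) + a * b * ?q n))
        {0..a * real (Suc i) + b * real n}" by auto
    also have "?I i n + (a\<^sup>2 * f (real i + 1/2) + a * b * ?q n) = ?I (Suc i) n"
      unfolding path by (simp add: algebra_simps)
    finally show ?thesis .
  qed
  have step_g: "(k has_integral ?I m (Suc j)) {0..a * real m + b * real (Suc j)}"
    if n: "n = Suc j" and before: "\<And>i. m = Suc i \<Longrightarrow> ?q n - ?q j \<le> ?p m - ?p i"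
      and path: "path_max ?p ?q m (Suc j) = ?p m + path_max ?p ?q m j" for j
  proof -
    have after: "dominates_after (?q (Suc j) - ?q j) m M f" using less.prems(4) n by simp
    have "(k has_integral ?I m j) {0..a * real m + b * real j}"
    proof (rule less.hyps)
      show "dominates_after (?q j - ?q j') m M f" if "j = Suc j'" for j'
        using dominates_after_mono[OF after] polygonal_concave_slopes[OF g, of j'] that n less.prems(2)
        by simp
      show "dominates_after (?p m - ?p i) j N g" if "m = Suc i" for i
        using dominates_after_mono[OF polygonal_concave_dominates_after[OF g, of j]]
          before[OF that] n less.prems(2) by simp
    qed (use n less.prems in auto)
    then have "(k has_integral ?I m j) {0..b * real j + a * real m}" by (simp only: add.commute)
    from sup_convolution_extend[OF g f sup_convolution_swap[OF k] ab(2,1) _ _ after _ this]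
      before n less.prems(1,2)
    have "(k has_integral ?I m j + (b\<^sup>2 * g (real j + 1/2) + b * a * ?p m))
        {0..b * real (Suc j) + a * real m}" by auto
    also have "?I m j + (b\<^sup>2 * g (real j + 1/2) + b * a * ?p m) = ?I m (Suc j)"
      unfolding path by (simp add: algebra_simps)
    also have "b * real (Suc j) + a * real m = a * real m + b * real (Suc j)" by simp
    finally show ?thesis .
  qed
  show ?case
  proof (cases m; cases n)
    assume "m = 0" "n = 0"
    then show ?thesis by (simp add: has_integral_refl)
  next
    fix j assume "m = 0" "n = Suc j"
    with step_g[of j] show ?thesis by simp
  next
    fix i assume "m = Suc i" "n = 0"
    with step_f[of i] show ?thesis by simp
  next
    fix i j assume eq: "m = Suc i" "n = Suc j"
    show ?thesis
    \<comment> \<open>Of the two edges that end at the corner, the one with the smaller slope is the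
      last step.\<close>
    proof (cases "?p m - ?p i \<le> ?q n - ?q j")
      case True
      then have "path_max ?p ?q (Suc i) (Suc j) = ?q (Suc j) + path_max ?p ?q i (Suc j)"
        using polygonal_concave_slopes[OF g] less.prems(2) eq
        by (intro path_max_greedy) auto
      with step_f[of i] True eq show ?thesis by simp
    next
      case False
      then have "path_max ?q ?p (Suc j) (Suc i) = ?p (Suc i) + path_max ?q ?p j (Suc i)"
        using polygonal_concave_slopes[OF f] less.prems(1) eq
        by (intro path_max_greedy) auto
      then have "path_max ?p ?q (Suc i) (Suc j) = ?p (Suc i) + path_max ?p ?q (Suc i) j"
        by (simp only: path_max_swap[of ?p ?q])
      with step_g[of j] False eq show ?thesis by simp
    qed
  qed
qed

text \<open>At the corner \<open>(M, N)\<close> nothing is left to dominate, so the slope conditions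
  hold trivially.\<close>

lemma has_integral_sup_convolution:
  assumes "polygonal_concave M f" "polygonal_concave N g"
    and "sup_convolution a b M N f g k" "0 \<le> a" "0 \<le> b"
  shows "(k has_integral (a\<^sup>2 * (\<Sum>i<M. f (real i + 1/2))
      + a * b * path_max (\<lambda>i. f (real i)) (\<lambda>j. g (real j)) M N
      + b\<^sup>2 * (\<Sum>j<N. g (real j + 1/2)))) {0..a * real M + b * real N}"
  using assms by (intro has_integral_sup_convolution_aux[where M = M and N = N])
    (auto simp: dominates_after_def)

section \<open>Fiber polytopes and mixed fiber polytopes\<close>

text \<open>The geometric form of \<open>path_max\<close>: maxima become convex hulls of unions, so
  a single body has the staircase maximum as its support value in every direction.\<close>

fun path_body :: "(nat \<Rightarrow> (real^'n) set) \<Rightarrow> (nat \<Rightarrow> (real^'n) set) \<Rightarrow> nat \<Rightarrow> nat \<Rightarrow> (real^'n) set" where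
  "path_body X Y 0 0 = {0}"
| "path_body X Y (Suc m) 0 = Y 0 + path_body X Y m 0"
| "path_body X Y 0 (Suc n) = X 0 + path_body X Y 0 n"
| "path_body X Y (Suc m) (Suc n) =
     convex hull ((Y (Suc n) + path_body X Y m (Suc n)) \<union> (X (Suc m) + path_body X Y (Suc m) n))"

lemma convex_body_path_body:
  assumes "\<And>i. i \<le> m \<Longrightarrow> convex_body (X i)" "\<And>j. j \<le> n \<Longrightarrow> convex_body (Y j)"
  shows "convex_body (path_body X Y m n)"
  using assms
  by (induction X Y m n rule: path_body.induct)
    (simp_all add: convex_body_singleton convex_body_plus convex_body_hull_Un)

lemma supp_path_body:
  assumes "\<And>i. i \<le> m \<Longrightarrow> convex_body (X i)" "\<And>j. j \<le> n \<Longrightarrow> convex_body (Y j)"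
  shows "supp (path_body X Y m n) v = path_max (\<lambda>i. supp (X i) v) (\<lambda>j. supp (Y j) v) m n"
  using assms
proof (induction X Y m n rule: path_body.induct)
  case (2 X Y m)
  then have "convex_body (path_body X Y m 0)" by (intro convex_body_path_body) auto
  with 2 show ?case by (simp add: supp_plus)
next
  case (3 X Y n)
  then have "convex_body (path_body X Y 0 n)" by (intro convex_body_path_body) auto
  with 3 show ?case by (simp add: supp_plus)
qed (simp_all add: supp_singleton supp_plus supp_hull_Un convex_body_plus convex_body_path_body)

text \<open>A convex combination of maximisers in two slices lies in the intermediate slice.\<close>

lemma supp_slice_concave:
  assumes "convex Q" "convex_body (slice u Q s)" "convex_body (slice u Q t)"
    and "0 \<le> \<theta>" "\<theta> \<le> 1" and c: "convex_body (slice u Q ((1 - \<theta>) * s + \<theta> * t))"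
  shows "(1 - \<theta>) * supp (slice u Q s) v + \<theta> * supp (slice u Q t) v
    \<le> supp (slice u Q ((1 - \<theta>) * s + \<theta> * t)) v"
proof -
  obtain x where x: "x \<in> slice u Q s" "supp (slice u Q s) v = v \<bullet> x"
    using supp_attained assms(2) unfolding convex_body_def by metis
  obtain y where y: "y \<in> slice u Q t" "supp (slice u Q t) v = v \<bullet> y"
    using supp_attained assms(3) unfolding convex_body_def by metis
  have "(1 - \<theta>) *\<^sub>R x + \<theta> *\<^sub>R y \<in> Q"
    using x y assms by (intro convexD_alt) (auto simp: slice_def)
  then have "(1 - \<theta>) *\<^sub>R x + \<theta> *\<^sub>R y \<in> slice u Q ((1 - \<theta>) * s + \<theta> * t)"
    using x y by (auto simp: slice_def inner_add_right)
  from supp_upper[OF _ this, of v] c show ?thesis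
    by (simp add: convex_body_def x y inner_add_right)
qed

text \<open>Beyond an edge, its nearer node lies between \<open>x\<close> and its farther node;
  solving the chord inequality there for \<open>f x\<close> gives the bound by the line along the
  edge.\<close>

lemma polygonal_concaveI:
  assumes affine: "\<And>i \<theta>. i < M \<Longrightarrow> 0 \<le> \<theta> \<Longrightarrow> \<theta> \<le> 1 \<Longrightarrow>
      f (real i + \<theta>) = f (real i) + \<theta> * (f (real (Suc i)) - f (real i))"
    and concave: "\<And>x y \<theta>. x \<in> {0..real M} \<Longrightarrow> y \<in> {0..real M} \<Longrightarrow> 0 \<le> \<theta> \<Longrightarrow> \<theta> \<le> 1 \<Longrightarrow>
      (1 - \<theta>) * f x + \<theta> * f y \<le> f ((1 - \<theta>) * x + \<theta> * y)"
  shows "polygonal_concave M f"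
  unfolding polygonal_concave_def
proof (intro conjI allI impI ballI)
  fix i x assume i: "i < M" and x: "x \<in> {0..real M}"
  consider "x < real i" | "real i \<le> x" "x \<le> real (Suc i)" | "real (Suc i) < x" by linarith
  then show "f x \<le> f (real i) + (f (real (Suc i)) - f (real i)) * (x - real i)"
  proof cases
    case 1
    define e where "e = real i - x"
    \<comment> \<open>Chosen so that \<open>real i\<close> is the combination of \<open>x\<close>
      and \<open>real (Suc i)\<close> with weight \<open>\<theta>\<close> on the latter.\<close>
    define \<theta> where "\<theta> = e / (1 + e)"
    have e: "e > 0" "(1 + e) * \<theta> = e" "0 \<le> \<theta>" "\<theta> \<le> 1"
      using 1 by (auto simp: e_def \<theta>_def)
    have "(1 - \<theta>) * x + \<theta> * real (Suc i) = x + (1 + e) * \<theta>"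
      by (simp add: e_def algebra_simps)
    then have "(1 - \<theta>) * x + \<theta> * real (Suc i) = real i" unfolding e(2) by (simp add: e_def)
    then have "(1 - \<theta>) * f x + \<theta> * f (real (Suc i)) \<le> f (real i)"
      using concave[of x "real (Suc i)" \<theta>] x i e(3,4) by simp
    then have "(1 + e) * ((1 - \<theta>) * f x + \<theta> * f (real (Suc i))) \<le> (1 + e) * f (real i)"
      using e(1) by (intro mult_left_mono) auto
    moreover have "(1 + e) * ((1 - \<theta>) * f x + \<theta> * f (real (Suc i)))
        = (1 + e - (1 + e) * \<theta>) * f x + ((1 + e) * \<theta>) * f (real (Suc i))"
      by (simp add: algebra_simps)
    ultimately have "f x \<le> f (real i) + (f (real (Suc i)) - f (real i)) * - e"
      unfolding e(2) by (simp add: algebra_simps)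
    then show ?thesis by (simp add: e_def)
  next
    case 2
    then show ?thesis using affine[of i "x - real i"] i by (simp add: mult.commute)
  next
    case 3
    define d where "d = x - real i"
    define \<theta> where "\<theta> = 1 / d"
    have d: "d > 0" "d * \<theta> = 1" "0 \<le> \<theta>" "\<theta> \<le> 1"
      using 3 by (auto simp: d_def \<theta>_def)
    have "(1 - \<theta>) * real i + \<theta> * x = real i + d * \<theta>" by (simp add: d_def algebra_simps)
    then have "(1 - \<theta>) * real i + \<theta> * x = real (Suc i)" using d by simp
    then have "(1 - \<theta>) * f (real i) + \<theta> * f x \<le> f (real (Suc i))"
      using concave[of "real i" x \<theta>] x i d by simp
    then have "d * ((1 - \<theta>) * f (real i) + \<theta> * f x) \<le> d * f (real (Suc i))"
      using d by (intro mult_left_mono) auto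
    moreover have "d * ((1 - \<theta>) * f (real i) + \<theta> * f x)
        = (d - d * \<theta>) * f (real i) + (d * \<theta>) * f x"
      by (simp add: algebra_simps)
    ultimately have "f x \<le> f (real i) + (f (real (Suc i)) - f (real i)) * d"
      unfolding d(2) by (simp add: algebra_simps)
    then show ?thesis by (simp add: d_def)
  qed
qed (use affine in auto)

text \<open>A natural number, so that it can count edges. The floor changes nothing for integral
  \<open>u\<close> and lattice polytopes, where both extreme levels are integers.\<close>

definition psi_width :: "real^'n \<Rightarrow> (real^'n) set \<Rightarrow> nat" where
  "psi_width u Q = nat \<lfloor>psi_max u Q - psi_min u Q\<rfloor>"

lemma psi_le: "convex_body Q \<Longrightarrow> psi_min u Q \<le> psi_max u Q"
  using psi_attained[of Q u] psi_bounds[of Q _ u] by (metis)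

lemma psi_max_eq_width:
  assumes "int_vec u" "lattice_polytope Q"
  shows "psi_max u Q = psi_min u Q + real (psi_width u Q)"
proof -
  have "psi_max u Q - psi_min u Q \<in> \<int>" using psi_Ints[OF assms] by auto
  moreover have "psi_min u Q \<le> psi_max u Q"
    using psi_le convex_body_lattice_polytope assms(2) by blast
  ultimately show ?thesis by (auto simp: psi_width_def elim!: Ints_cases)
qed

lemma convex_body_slice_width:
  assumes "int_vec u" "lattice_polytope Q" "0 \<le> x" "x \<le> real (psi_width u Q)"
  shows "convex_body (slice u Q (psi_min u Q + x))"
  using assms psi_max_eq_width[OF assms(1,2)]
  by (intro convex_body_slice convex_body_lattice_polytope) auto

text \<open>This function is the upper boundary of the projection of \<open>Q\<close> by
  \<open>u\<close> and \<open>v\<close>. It is affine between integer levels by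
  \<open>slice_lattice_polytope\<close>, and concave because \<open>Q\<close> is convex.\<close>

lemma polygonal_concave_supp_slice:
  assumes u: "int_vec u" and Q: "lattice_polytope Q"
  shows "polygonal_concave (psi_width u Q) (\<lambda>x. supp (slice u Q (psi_min u Q + x)) v)"
proof (rule polygonal_concaveI)
  note body = convex_body_slice_width[OF u Q]
  fix i :: nat and \<theta> :: real assume i: "i < psi_width u Q" and \<theta>: "0 \<le> \<theta>" "\<theta> \<le> 1"
  obtain m :: int where m: "psi_min u Q = of_int m" using psi_Ints[OF u Q] by (auto elim: Ints_cases)
  have "slice u Q (of_int (m + int i) + \<theta>) = (\<lambda>x. (1 - \<theta>) *\<^sub>R x) ` slice u Q (of_int (m + int i))
      + (\<lambda>x. \<theta> *\<^sub>R x) ` slice u Q (of_int (m + int i) + 1)"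
    using slice_lattice_polytope[OF u Q _ _ \<theta>, of "m + int i"] m i psi_max_eq_width[OF u Q] by simp
  moreover have "convex_body (slice u Q (of_int (m + int i)))"
      "convex_body (slice u Q (of_int (m + int i) + 1))"
    using body[of "real i"] body[of "real (Suc i)"] i m by (simp_all add: ac_simps)
  ultimately have "supp (slice u Q (of_int (m + int i) + \<theta>)) v =
      (1 - \<theta>) * supp (slice u Q (of_int (m + int i))) v
      + \<theta> * supp (slice u Q (of_int (m + int i) + 1)) v"
    using \<theta> by (simp add: supp_plus supp_scale convex_body_scale)
  then show "supp (slice u Q (psi_min u Q + (real i + \<theta>))) v = supp (slice u Q (psi_min u Q + real i)) v
      + \<theta> * (supp (slice u Q (psi_min u Q + real (Suc i))) v - supp (slice u Q (psi_min u Q + real i)) v)"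
    unfolding m by (simp add: algebra_simps)
next
  note body = convex_body_slice_width[OF u Q]
  fix x y \<theta> :: real
  assume *: "x \<in> {0..real (psi_width u Q)}" "y \<in> {0..real (psi_width u Q)}" "0 \<le> \<theta>" "\<theta> \<le> 1"
  have "(1 - \<theta>) * x + \<theta> * y \<in> {0..real (psi_width u Q)}"
    using * convexD_alt[of "{0..real (psi_width u Q)}" x y \<theta>] by simp
  moreover have "(1 - \<theta>) * (psi_min u Q + x) + \<theta> * (psi_min u Q + y)
      = psi_min u Q + ((1 - \<theta>) * x + \<theta> * y)" by (simp add: algebra_simps)
  ultimately show "(1 - \<theta>) * supp (slice u Q (psi_min u Q + x)) v
      + \<theta> * supp (slice u Q (psi_min u Q + y)) v
    \<le> supp (slice u Q (psi_min u Q + ((1 - \<theta>) * x + \<theta> * y))) v"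
    using supp_slice_concave[of Q u "psi_min u Q + x" "psi_min u Q + y" \<theta> v] * body
      convex_body_lattice_polytope[OF Q] by (simp add: convex_body_def)
qed

section \<open>Weighted Minkowski combinations of two polytopes\<close>

abbreviation combination :: "real \<Rightarrow> real \<Rightarrow> (real^'n) set \<Rightarrow> (real^'n) set \<Rightarrow> (real^'n) set" where
  "combination a b C D \<equiv> (\<lambda>x. a *\<^sub>R x) ` C + (\<lambda>x. b *\<^sub>R x) ` D"

lemma supp_combination:
  assumes "convex_body C" "convex_body D" "0 \<le> a" "0 \<le> b"
  shows "supp (combination a b C D) v = a * supp C v + b * supp D v"
  using assms by (simp add: supp_plus supp_scale convex_body_scale)

lemma psi_combination:
  assumes "convex_body C" "convex_body D" "0 \<le> a" "0 \<le> b"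
  shows "psi_min u (combination a b C D) = a * psi_min u C + b * psi_min u D"
    and "psi_max u (combination a b C D) = a * psi_max u C + b * psi_max u D"
  using supp_combination[OF assms] by (simp_all add: psi_min_eq_supp psi_max_eq_supp)

text \<open>A point of the combination splits as \<open>a *\<^sub>R c + b *\<^sub>R d\<close>, and
  its level splits accordingly. Maximisers in the two slices of an optimal pair of levels therefore
  combine to a maximiser over the whole slice.\<close>

lemma sup_convolution_slice_combination:
  assumes u: "int_vec u" and C: "lattice_polytope C" and D: "lattice_polytope D"
    and ab: "0 \<le> a" "0 \<le> b"
  shows "sup_convolution a b (psi_width u C) (psi_width u D)
    (\<lambda>x. supp (slice u C (psi_min u C + x)) v) (\<lambda>y. supp (slice u D (psi_min u D + y)) v)
    (\<lambda>t. supp (slice u (combination a b C D) (psi_min u (combination a b C D) + t)) v)"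
  unfolding sup_convolution_def
proof (intro ballI impI)
  let ?f = "\<lambda>x. supp (slice u C (psi_min u C + x)) v"
  let ?g = "\<lambda>y. supp (slice u D (psi_min u D + y)) v"
  fix x y assume x: "x \<in> {0..real (psi_width u C)}" and y: "y \<in> {0..real (psi_width u D)}"
    and opt: "\<forall>x'\<in>{0..real (psi_width u C)}. \<forall>y'\<in>{0..real (psi_width u D)}.
      a * x' + b * y' = a * x + b * y \<longrightarrow> a * ?f x' + b * ?g y' \<le> a * ?f x + b * ?g y"
  note Cb = convex_body_lattice_polytope[OF C] and Db = convex_body_lattice_polytope[OF D]
  have body: "convex_body (slice u C (psi_min u C + x))" "convex_body (slice u D (psi_min u D + y))"
    using convex_body_slice_width[OF u C] convex_body_slice_width[OF u D] x y by auto
  obtain p where p: "p \<in> slice u C (psi_min u C + x)" "?f x = v \<bullet> p"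
    using supp_attained body(1) unfolding convex_body_def by metis
  obtain q where q: "q \<in> slice u D (psi_min u D + y)" "?g y = v \<bullet> q"
    using supp_attained body(2) unfolding convex_body_def by metis
  let ?S = "slice u (combination a b C D) (psi_min u (combination a b C D) + (a * x + b * y))"
  have "supp ?S v = v \<bullet> (a *\<^sub>R p + b *\<^sub>R q)"
  proof (rule supp_eqI)
    show "a *\<^sub>R p + b *\<^sub>R q \<in> ?S"
      using p q psi_combination(1)[OF Cb Db ab]
      by (auto simp: slice_def inner_add_right algebra_simps)
    fix z assume "z \<in> ?S"
    then obtain c d where z: "c \<in> C" "d \<in> D" "z = a *\<^sub>R c + b *\<^sub>R d"
      "u \<bullet> z = psi_min u (combination a b C D) + (a * x + b * y)"
      by (auto simp: slice_def elim!: set_plus_elim)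
    let ?x = "u \<bullet> c - psi_min u C" and ?y = "u \<bullet> d - psi_min u D"
    have xy: "?x \<in> {0..real (psi_width u C)}" "?y \<in> {0..real (psi_width u D)}"
      using psi_bounds[OF Cb z(1), of u] psi_bounds[OF Db z(2), of u]
        psi_max_eq_width[OF u C] psi_max_eq_width[OF u D] by auto
    moreover have "a * ?x + b * ?y = a * x + b * y"
      using z(4) psi_combination(1)[OF Cb Db ab] by (simp add: z(3) inner_add_right algebra_simps)
    ultimately have "a * ?f ?x + b * ?g ?y \<le> a * ?f x + b * ?g y"
      using opt by blast
    moreover have "v \<bullet> c \<le> ?f ?x" "v \<bullet> d \<le> ?g ?y"
      using convex_body_slice_width[OF u C, of ?x] convex_body_slice_width[OF u D, of ?y] xy z
      by (auto intro!: supp_upper simp: convex_body_def slice_def)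
    then have "a * (v \<bullet> c) + b * (v \<bullet> d) \<le> a * ?f ?x + b * ?g ?y"
      using ab by (intro add_mono mult_left_mono)
    ultimately show "v \<bullet> z \<le> v \<bullet> (a *\<^sub>R p + b *\<^sub>R q)"
      by (simp add: z(3) inner_add_right p(2)[symmetric] q(2)[symmetric])
  qed
  then show "supp ?S v = a * ?f x + b * ?g y" by (simp add: inner_add_right p(2) q(2))
qed

text \<open>Indexed from the lowest level, to match \<open>polygonal_concave\<close>;
  \<open>slice_sum_eq_int_range\<close> returns to absolute levels.\<close>

definition slice_sum :: "real^'n \<Rightarrow> (real^'n) set \<Rightarrow> (real^'n) set" where
  "slice_sum u Q = (\<Sum>i<psi_width u Q. slice u Q (psi_min u Q + (real i + 1/2)))"

text \<open>Built from slices at integer levels, this is the mixed fiber polytope by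
  \<open>mixed_fiber_polytope_lattice\<close>.\<close>

definition staircase_body :: "real^'n \<Rightarrow> (real^'n) set \<Rightarrow> (real^'n) set \<Rightarrow> (real^'n) set" where
  "staircase_body u C D = path_body (\<lambda>i. slice u C (psi_min u C + real i))
     (\<lambda>j. slice u D (psi_min u D + real j)) (psi_width u C) (psi_width u D)"

lemma convex_body_slice_sum:
  assumes "int_vec u" "lattice_polytope Q"
  shows "convex_body (slice_sum u Q)"
  unfolding slice_sum_def using assms
  by (intro convex_body_sum convex_body_slice_width) auto

lemma convex_body_staircase_body:
  assumes "int_vec u" "lattice_polytope C" "lattice_polytope D"
  shows "convex_body (staircase_body u C D)"
  unfolding staircase_body_def using assms
  by (intro convex_body_path_body convex_body_slice_width) auto

lemma fiber_polytope_eqI: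
  assumes S: "convex_body S"
    and supp: "\<And>v. ((\<lambda>t. supp (slice u Q t) v) has_integral supp S v) {psi_min u Q..psi_max u Q}"
  shows "fiber_polytope u Q = S"
  unfolding fiber_polytope_def mink_integral_def slice_def[symmetric]
proof (rule the_equality)
  show "compact S \<and> convex S \<and> S \<noteq> {} \<and>
      (\<forall>v. supp S v = integral {psi_min u Q..psi_max u Q} (\<lambda>t. supp (slice u Q t) v))"
    using S integral_unique[OF supp] by (simp add: convex_body_def)
next
  fix T assume "compact T \<and> convex T \<and> T \<noteq> {} \<and>
      (\<forall>v. supp T v = integral {psi_min u Q..psi_max u Q} (\<lambda>t. supp (slice u Q t) v))"
  then show "T = S"
    using S integral_unique[OF supp] by (intro supp_inject) (auto simp: convex_body_def)
qed

text \<open>Support functions are compared in each direction: the three coefficients in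
  \<open>has_integral_sup_convolution\<close> are the support values of the three bodies.\<close>

lemma fiber_polytope_combination:
  assumes u: "int_vec u" and C: "lattice_polytope C" and D: "lattice_polytope D"
    and ab: "0 \<le> a" "0 \<le> b"
  shows "fiber_polytope u (combination a b C D) =
    (\<lambda>x. a\<^sup>2 *\<^sub>R x) ` slice_sum u C + (\<lambda>x. (a * b) *\<^sub>R x) ` staircase_body u C D
      + (\<lambda>x. b\<^sup>2 *\<^sub>R x) ` slice_sum u D"
proof (rule fiber_polytope_eqI)
  note Cb = convex_body_lattice_polytope[OF C] and Db = convex_body_lattice_polytope[OF D]
  note bodies = convex_body_slice_sum[OF u C] convex_body_slice_sum[OF u D]
    convex_body_staircase_body[OF u C D]
  let ?R = "(\<lambda>x. a\<^sup>2 *\<^sub>R x) ` slice_sum u C + (\<lambda>x. (a * b) *\<^sub>R x) ` staircase_body u C D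
      + (\<lambda>x. b\<^sup>2 *\<^sub>R x) ` slice_sum u D"
  show "convex_body ?R" using bodies by (simp add: convex_body_plus convex_body_scale)
  fix v
  let ?Q = "combination a b C D"
  let ?f = "\<lambda>x. supp (slice u C (psi_min u C + x)) v"
  let ?g = "\<lambda>y. supp (slice u D (psi_min u D + y)) v"
  have "supp (slice_sum u C) v = (\<Sum>i<psi_width u C. ?f (real i + 1/2))"
    unfolding slice_sum_def by (intro supp_sum convex_body_slice_width u C) auto
  moreover have "supp (slice_sum u D) v = (\<Sum>j<psi_width u D. ?g (real j + 1/2))"
    unfolding slice_sum_def by (intro supp_sum convex_body_slice_width u D) auto
  moreover have "supp (staircase_body u C D) v =
      path_max (\<lambda>i. ?f (real i)) (\<lambda>j. ?g (real j)) (psi_width u C) (psi_width u D)"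
    unfolding staircase_body_def by (intro supp_path_body convex_body_slice_width u C D) auto
  ultimately have "((\<lambda>t. supp (slice u ?Q (psi_min u ?Q + t)) v) has_integral supp ?R v)
      {0..a * real (psi_width u C) + b * real (psi_width u D)}"
    using has_integral_sup_convolution[OF polygonal_concave_supp_slice[OF u C]
        polygonal_concave_supp_slice[OF u D] sup_convolution_slice_combination[OF u C D ab] ab, of v]
      bodies ab by (simp add: supp_plus supp_scale convex_body_plus convex_body_scale)
  moreover have "psi_max u ?Q = psi_min u ?Q + (a * real (psi_width u C) + b * real (psi_width u D))"
    by (simp add: psi_combination[OF Cb Db ab] psi_max_eq_width[OF u C] psi_max_eq_width[OF u D]
        algebra_simps)
  \<comment> \<open>Levels were measured from the minimum; a shift of the integral returns to
    absolute levels.\<close>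
  ultimately show "((\<lambda>t. supp (slice u ?Q t) v) has_integral supp ?R v) {psi_min u ?Q..psi_max u ?Q}"
    using has_integral_shift_Icc_real[of "\<lambda>t. supp (slice u ?Q t) v" "psi_min u ?Q" "supp ?R v"
        0 "a * real (psi_width u C) + b * real (psi_width u D)"]
    by (simp add: comp_def add.commute)
qed

text \<open>The weights \<open>1\<close> and \<open>0\<close> reduce everything but the first
  summand to \<open>{0}\<close>; nonemptiness ensures that scaling by \<open>0\<close> gives
  \<open>{0}\<close> and not the empty set.\<close>

lemma fiber_polytope_lattice:
  assumes u: "int_vec u" and Q: "lattice_polytope Q"
  shows "fiber_polytope u Q = slice_sum u Q"
proof -
  have "Q \<noteq> {}" "slice_sum u Q \<noteq> {}" "staircase_body u Q Q \<noteq> {}"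
    using convex_body_lattice_polytope[OF Q] convex_body_slice_sum[OF u Q]
      convex_body_staircase_body[OF u Q Q] by (auto simp: convex_body_def)
  then show ?thesis
    using fiber_polytope_combination[OF u Q Q, of 1 0] by (simp add: image_constant_conv)
qed

text \<open>For uniqueness, the weights \<open>(1, 0)\<close> and \<open>(0, 1)\<close> determine
  the two pure coefficients, and \<open>(1, 1)\<close> then determines the mixed one by
  cancellation.\<close>

lemma mixed_fiber_polytope_lattice:
  assumes u: "int_vec u" and C: "lattice_polytope C" and D: "lattice_polytope D"
  shows "mixed_fiber_polytope u C D = staircase_body u C D"
  unfolding mixed_fiber_polytope_def
proof (rule the_equality, goal_cases)
  case 1
  note bodies = convex_body_slice_sum[OF u C] convex_body_slice_sum[OF u D]
    convex_body_staircase_body[OF u C D]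
  show ?case
    using bodies fiber_polytope_combination[OF u C D] unfolding convex_body_def by blast
next
  case (2 M)
  then obtain M1 M2 where M: "convex_body M" "convex_body M1" "convex_body M2"
    and eq: "\<And>l1 l2. 0 \<le> l1 \<Longrightarrow> 0 \<le> l2 \<Longrightarrow> fiber_polytope u (combination l1 l2 C D) =
      (\<lambda>x. l1\<^sup>2 *\<^sub>R x) ` M1 + (\<lambda>x. (l1 * l2) *\<^sub>R x) ` M + (\<lambda>x. l2\<^sup>2 *\<^sub>R x) ` M2"
    unfolding convex_body_def by blast
  note bodies = convex_body_slice_sum[OF u C] convex_body_slice_sum[OF u D]
    convex_body_staircase_body[OF u C D]
  have ne: "M \<noteq> {}" "M1 \<noteq> {}" "M2 \<noteq> {}" "slice_sum u C \<noteq> {}" "slice_sum u D \<noteq> {}"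
    "staircase_body u C D \<noteq> {}"
    using M bodies by (auto simp: convex_body_def)
  have "M1 = slice_sum u C"
    using eq[of 1 0] fiber_polytope_combination[OF u C D, of 1 0] ne by (simp add: image_constant_conv)
  moreover have "M2 = slice_sum u D"
    using eq[of 0 1] fiber_polytope_combination[OF u C D, of 0 1] ne by (simp add: image_constant_conv)
  moreover have "M1 + M + M2 = slice_sum u C + staircase_body u C D + slice_sum u D"
    using eq[of 1 1] fiber_polytope_combination[OF u C D, of 1 1] by simp
  ultimately have "(slice_sum u C + slice_sum u D) + M
      = (slice_sum u C + slice_sum u D) + staircase_body u C D"
    by (simp only: ac_simps)
  then show ?case
    using convex_body_add_left_cancel[OF convex_body_plus[OF bodies(1,2)] M(1) bodies(3)] by blast
qed

lemma slice_sum_plus: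
  assumes u: "int_vec u" and C: "lattice_polytope C" and D: "lattice_polytope D"
  shows "slice_sum u (C + D) = slice_sum u C + mixed_fiber_polytope u C D + slice_sum u D"
  using fiber_polytope_combination[OF u C D, of 1 1]
    fiber_polytope_lattice[OF u lattice_polytope_plus[OF C D]]
    mixed_fiber_polytope_lattice[OF u C D] by simp

section \<open>Faces\<close>

lemma slice_sum_eq_int_range:
  assumes u: "int_vec u" and Q: "lattice_polytope Q"
  shows "slice_sum u Q = (\<Sum>i\<in>int_range (psi_min u Q) (psi_max u Q). slice u Q (of_int i + 1/2))"
proof -
  obtain m :: int where m: "psi_min u Q = of_int m" using psi_Ints[OF u Q] by (auto elim: Ints_cases)
  have "bij_betw (\<lambda>i. m + int i) {..<psi_width u Q} (int_range (psi_min u Q) (psi_max u Q))"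
    using psi_max_eq_width[OF u Q] m
    by (intro bij_betw_byWitness[where f' = "\<lambda>k. nat (k - m)"]) (auto simp: int_range_def)
  from sum.reindex_bij_betw[OF this, of "\<lambda>i. slice u Q (of_int i + 1/2)"] show ?thesis
    unfolding slice_sum_def m by (simp add: add.assoc)
qed

lemma slice_face_eq: "slice_face u w Q i = face w (slice u Q (of_int i + 1/2))"
  by (simp add: slice_face_def slice_def)

lemma finite_int_range [simp]: "finite (int_range a b)"
proof (rule finite_subset)
  show "int_range a b \<subseteq> {\<lceil>a\<rceil>..\<lfloor>b\<rfloor>}" by (auto simp: int_range_def ceiling_le_iff le_floor_iff)
qed simp

text \<open>As \<open>b\<close> is an integer, no index lies strictly between \<open>b - 1\<close>
  and \<open>b\<close>, where neither part would contain it.\<close>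

lemma sum_int_range_split:
  fixes F :: "int \<Rightarrow> 'a::comm_monoid_add"
  assumes "a \<le> b" "b \<le> c" "b \<in> \<int>"
  shows "(\<Sum>i\<in>int_range a c. F i) = (\<Sum>i\<in>int_range a b. F i) + (\<Sum>i\<in>int_range b c. F i)"
proof -
  obtain k :: int where "b = of_int k" using assms(3) by (auto elim: Ints_cases)
  then have "int_range a c = int_range a b \<union> int_range b c" "int_range a b \<inter> int_range b c = {}"
    using assms(1,2) by (auto simp: int_range_def)
  then show ?thesis by (simp add: sum.union_disjoint)
qed

text \<open>Once the slice meets \<open>face w Q\<close>, the maximum of \<open>w\<close> over the
  slice is its maximum over \<open>Q\<close>.\<close>

lemma face_slice_eq:
  assumes "slice u (face w Q) t \<noteq> {}"
  shows "face w (slice u Q t) = slice u (face w Q) t"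
  using assms unfolding face_def slice_def by (auto intro: order_trans)

lemma psi_face_bounds:
  assumes "convex_body Q"
  shows "psi_min u (face w Q) \<in> {psi_min u Q..psi_max u Q}"
    and "psi_max u (face w Q) \<in> {psi_min u Q..psi_max u Q}"
proof -
  obtain x y where "x \<in> face w Q" "u \<bullet> x = psi_min u (face w Q)"
    "y \<in> face w Q" "u \<bullet> y = psi_max u (face w Q)"
    using psi_attained[OF convex_body_face[OF assms]] by blast
  then show "psi_min u (face w Q) \<in> {psi_min u Q..psi_max u Q}"
    "psi_max u (face w Q) \<in> {psi_min u Q..psi_max u Q}"
    using psi_bounds[OF assms, of x u] psi_bounds[OF assms, of y u] by (auto simp: face_def)
qed

text \<open>The levels of \<open>Q\<close> fall into those below, along and above
  \<open>face w Q\<close>; along it, \<open>face_slice_eq\<close> turns faces of slices into slices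
  of the face.\<close>

lemma face_slice_sum:
  assumes u: "int_vec u" and Q: "lattice_polytope Q"
  shows "face w (slice_sum u Q) = slice_sum u (face w Q)
    + (\<Sum>i\<in>int_range (psi_min u Q) (psi_min u (face w Q)). slice_face u w Q i)
    + (\<Sum>i\<in>int_range (psi_max u (face w Q)) (psi_max u Q). slice_face u w Q i)"
proof -
  let ?F = "face w Q"
  note F = lattice_polytope_face[OF Q, of w]
  note Qb = convex_body_lattice_polytope[OF Q] and Fb = convex_body_lattice_polytope[OF F]
  have body: "convex_body (slice u Q (of_int i + 1/2))" if "i \<in> int_range (psi_min u Q) (psi_max u Q)" for i
    using that by (intro convex_body_slice Qb) (auto simp: int_range_def)
  have le: "psi_min u Q \<le> psi_min u ?F" "psi_min u ?F \<le> psi_max u ?F" "psi_max u ?F \<le> psi_max u Q"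
    using psi_face_bounds[OF Qb, of u w] psi_le[OF Fb, of u] by auto
  have "face w (slice_sum u Q) = (\<Sum>i\<in>int_range (psi_min u Q) (psi_max u Q). slice_face u w Q i)"
    unfolding slice_sum_eq_int_range[OF u Q] slice_face_eq by (intro face_sum body) simp
  also have "\<dots> = (\<Sum>i\<in>int_range (psi_min u Q) (psi_min u ?F). slice_face u w Q i)
      + ((\<Sum>i\<in>int_range (psi_min u ?F) (psi_max u ?F). slice_face u w Q i)
      + (\<Sum>i\<in>int_range (psi_max u ?F) (psi_max u Q). slice_face u w Q i))"
    using le psi_Ints[OF u F]
    by (simp only: sum_int_range_split[of "psi_min u Q" "psi_min u ?F" "psi_max u Q"]
        sum_int_range_split[of "psi_min u ?F" "psi_max u ?F" "psi_max u Q"] order_trans)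
  also have "(\<Sum>i\<in>int_range (psi_min u ?F) (psi_max u ?F). slice_face u w Q i) = slice_sum u ?F"
    unfolding slice_sum_eq_int_range[OF u F]
  proof (rule sum.cong[OF refl])
    fix i assume "i \<in> int_range (psi_min u ?F) (psi_max u ?F)"
    then have "convex_body (slice u ?F (of_int i + 1/2))"
      by (intro convex_body_slice Fb) (auto simp: int_range_def)
    then show "slice_face u w Q i = slice u ?F (of_int i + 1/2)"
      unfolding slice_face_eq by (intro face_slice_eq) (simp add: convex_body_def)
  qed
  finally show ?thesis by (simp only: ac_simps)
qed

lemma convex_body_slice_face_sum:
  assumes Q: "convex_body Q" and ab: "psi_min u Q \<le> a" "b \<le> psi_max u Q"
  shows "convex_body (\<Sum>i\<in>int_range a b. slice_face u w Q i)"
  unfolding slice_face_eq using assms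
  by (intro convex_body_sum convex_body_face convex_body_slice) (auto simp: int_range_def)

theorem theorem4p9:
  fixes u w :: "real^'n" and C D :: "(real^'n) set"
  assumes "int_vec u"
    and "lattice_polytope C" and "lattice_polytope D"
  shows "mixed_fiber_polytope u (face w C) (face w D)
       + (\<Sum>i\<in>int_range (psi_min u (C + D)) (psi_min u (face w (C + D))). slice_face u w (C + D) i)
       + (\<Sum>i\<in>int_range (psi_max u (face w (C + D))) (psi_max u (C + D)). slice_face u w (C + D) i)
     = face w (mixed_fiber_polytope u C D)
       + (\<Sum>i\<in>int_range (psi_min u C) (psi_min u (face w C)). slice_face u w C i)
       + (\<Sum>i\<in>int_range (psi_max u (face w C)) (psi_max u C). slice_face u w C i)
       + (\<Sum>i\<in>int_range (psi_min u D) (psi_min u (face w D)). slice_face u w D i)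
       + (\<Sum>i\<in>int_range (psi_max u (face w D)) (psi_max u D). slice_face u w D i)"
    (is "?MF + ?a + ?b = ?FM + ?c + ?d + ?e + ?f")
proof (rule convex_body_add_left_cancel)
  note u = assms(1) and C = assms(2) and D = assms(3)
  note F = lattice_polytope_face[OF C, of w] and G = lattice_polytope_face[OF D, of w]
  note CD = lattice_polytope_plus[OF C D]
  have M: "convex_body (mixed_fiber_polytope u C D)" "convex_body ?MF"
    unfolding mixed_fiber_polytope_lattice[OF u C D] mixed_fiber_polytope_lattice[OF u F G]
    by (intro convex_body_staircase_body u C D F G)+
  note S = convex_body_slice_sum[OF u]
  have tails: "convex_body (\<Sum>i\<in>int_range (psi_min u Q) (psi_min u (face w Q)). slice_face u w Q i)"
    "convex_body (\<Sum>i\<in>int_range (psi_max u (face w Q)) (psi_max u Q). slice_face u w Q i)"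
    if "lattice_polytope Q" for Q
    using convex_body_lattice_polytope[OF that]
      psi_face_bounds[OF convex_body_lattice_polytope[OF that], of u w]
    by (auto intro!: convex_body_slice_face_sum)
  \<comment> \<open>\<open>?K\<close> is common to both expansions: it collects the pure terms for
    \<open>face w C + face w D\<close>, and also the middle parts of the faces of
    \<open>slice_sum u C\<close> and \<open>slice_sum u D\<close>.\<close>
  let ?K = "slice_sum u (face w C) + slice_sum u (face w D)"
  show "convex_body ?K" by (intro convex_body_plus S F G)
  show "convex_body (?MF + ?a + ?b)" by (intro convex_body_plus M tails CD)
  show "convex_body (?FM + ?c + ?d + ?e + ?f)"
    by (intro convex_body_plus convex_body_face M tails C D)
  have "face w (C + D) = face w C + face w D"
    using C D by (intro face_plus convex_body_lattice_polytope)
  \<comment> \<open>The face of \<open>slice_sum u (C + D)\<close> is computed twice: by splitting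
    off the tails first, and by expanding the sum before taking faces.\<close>
  then have "?K + (?MF + ?a + ?b) = face w (slice_sum u (C + D))"
    unfolding face_slice_sum[OF u CD] by (simp only: slice_sum_plus[OF u F G] ac_simps)
  also have "\<dots> = face w (slice_sum u C) + ?FM + face w (slice_sum u D)"
    unfolding slice_sum_plus[OF u C D] using S C D M
    by (simp only: face_plus convex_body_plus)
  also have "\<dots> = ?K + (?FM + ?c + ?d + ?e + ?f)"
    unfolding face_slice_sum[OF u C] face_slice_sum[OF u D] by (simp only: ac_simps)
  finally show "?K + (?MF + ?a + ?b) = ?K + (?FM + ?c + ?d + ?e + ?f)" .
qed

end
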